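(* Let $G$ be a Helly graph and $k$ a non-negative integer. (i) $hb(G)\le k$ if and only if there are no four vertices that induce a $C_4$ in $G^\ell$ for every integer $\ell\in[k+1,2k]$ and induce a diamond in $G^{2k+1}$. (ii) $hb(G)\le k+\frac12$ if and only if there are no four vertices that induce a $C_4$ in $G^\ell$ for every integer $\ell\in[k+1,2k+1]$, and there are no four vertices that induce a $C_4$ in $G^\ell$ for every integer $\ell\in[k+2,2k+2]$.
   Context: Graphs are finite, connected, unweighted, undirected and simple; $d$ is the shortest-path distance. A graph is Helly if every family of pairwise intersecting disks $D(v,r)=\{u:d(u,v)\le r\}$ has a common vertex. $hb(G)$ is the maximum over quadruples $u,v,w,x$ of one half of the difference between the two largest of $d(u,v)+d(w,x)$, $d(u,w)+d(v,x)$, $d(u,x)+d(v,w)$. $G^\ell$ is the graph on $V(G)$ with $uv$ an edge iff $0<d(u,v)\le \ell$; $C_4$ is the cycle on four vertices; a diamond is a cycle on four vertices with exactly one chord. *)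

theory Defs
  imports "Graph_Theory.Graph_Theory"
begin

text \<open>A finite simple undirected graph is an instance of the locale \<open>pair_graph\<close>: finitely many
  vertices, a symmetric arc relation, no loops and no parallel arcs.\<close>

definition gdist :: "'a pair_pre_digraph \<Rightarrow> 'a \<Rightarrow> 'a \<Rightarrow> nat" where
  "gdist G u v = (LEAST n. \<exists>p. pre_digraph.awalk G u p v \<and> length p = n)"

text \<open>Agreement with the weighted distance of \<open>Shortest_Path\<close> for unit weights. If \<open>v\<close> is not
  reachable from \<open>u\<close>, then \<open>gdist\<close> is unspecified.\<close>

lemma (in pair_wf_digraph) gdist_eq_mu:
  assumes "u \<rightarrow>\<^sup>*\<^bsub>G\<^esub> v"
  shows "\<mu> (\<lambda>_. 1) u v = ereal (real (gdist G u v))"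
proof -
  have cost: "awalk_cost (\<lambda>_. 1) p = real (length p)" for p
    by (induction p) auto
  obtain q where "awalk u q v"
    using assms by (auto simp: reachable_awalk)
  hence "\<exists>n p. awalk u p v \<and> length p = n" by blast
  hence "\<exists>p. awalk u p v \<and> length p = gdist G u v"
    unfolding gdist_def by (rule LeastI_ex)
  then obtain p where p: "awalk u p v" "length p = gdist G u v" by blast
  have le: "gdist G u v \<le> length q'" if "awalk u q' v" for q'
    unfolding gdist_def using that by (intro Least_le) blast
  show ?thesis
    unfolding \<mu>_def
  proof (rule antisym)
    show "(INF p\<in>{p. awalk u p v}. ereal (awalk_cost (\<lambda>_. 1) p)) \<le> ereal (real (gdist G u v))"
      using p by (intro INF_lower2[of p]) (auto simp: cost)
    show "ereal (real (gdist G u v)) \<le> (INF p\<in>{p. awalk u p v}. ereal (awalk_cost (\<lambda>_. 1) p))"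
      using le by (intro INF_greatest) (auto simp: cost)
  qed
qed

definition disk :: "'a pair_pre_digraph \<Rightarrow> 'a \<Rightarrow> nat \<Rightarrow> 'a set" where
  "disk G v r = {u \<in> pverts G. gdist G u v \<le> r}"

definition Helly_graph :: "'a pair_pre_digraph \<Rightarrow> bool" where
  "Helly_graph G \<longleftrightarrow> pair_graph G \<and> connected G \<and>
     (\<forall>F \<subseteq> {disk G v r | v r. v \<in> pverts G}.
        (\<forall>A\<in>F. \<forall>B\<in>F. A \<inter> B \<noteq> {}) \<longrightarrow> (\<exists>c\<in>pverts G. \<forall>A\<in>F. c \<in> A))"

text \<open>\<open>sort\<close> is ascending, so positions 2 and 1 hold the two largest of the three sums. Vertices of
  a quadruple may coincide; such quadruples contribute 0.\<close>

definition quad_hb :: "'a pair_pre_digraph \<Rightarrow> 'a \<Rightarrow> 'a \<Rightarrow> 'a \<Rightarrow> 'a \<Rightarrow> real" where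
  "quad_hb G u v w x =
     (let s = sort [gdist G u v + gdist G w x,
                    gdist G u w + gdist G v x,
                    gdist G u x + gdist G v w]
      in (real (s ! 2) - real (s ! 1)) / 2)"

definition hb :: "'a pair_pre_digraph \<Rightarrow> real" where
  "hb G = Max {quad_hb G u v w x | u v w x.
     u \<in> pverts G \<and> v \<in> pverts G \<and> w \<in> pverts G \<and> x \<in> pverts G}"

definition graph_power :: "'a pair_pre_digraph \<Rightarrow> nat \<Rightarrow> 'a pair_pre_digraph" where
  "graph_power G l = \<lparr> pverts = pverts G,
     parcs = {(u, v). u \<in> pverts G \<and> v \<in> pverts G \<and> 0 < gdist G u v \<and> gdist G u v \<le> l} \<rparr>"

definition is_C4 :: "('a, 'b) pre_digraph \<Rightarrow> bool" where
  "is_C4 H \<longleftrightarrow> (\<exists>a b c d. distinct [a, b, c, d] \<and> verts H = {a, b, c, d} \<and>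
     arcs_ends H = (let E = {(a, b), (b, c), (c, d), (d, a)} in E \<union> E\<inverse>))"

definition is_diamond :: "('a, 'b) pre_digraph \<Rightarrow> bool" where
  "is_diamond H \<longleftrightarrow> (\<exists>a b c d. distinct [a, b, c, d] \<and> verts H = {a, b, c, d} \<and>
     arcs_ends H = (let E = {(a, b), (b, c), (c, d), (d, a), (a, c)} in E \<union> E\<inverse>))"

text \<open>The side condition is needed because \<open>H \<restriction> S\<close> has vertex set \<open>S\<close> even if
  \<open>S\<close> is not contained in \<open>verts H\<close>.\<close>

definition induces_C4 :: "('a, 'b) pre_digraph \<Rightarrow> 'a set \<Rightarrow> bool" where
  "induces_C4 H S \<longleftrightarrow> S \<subseteq> verts H \<and> is_C4 (H \<restriction> S)"

definition induces_diamond :: "('a, 'b) pre_digraph \<Rightarrow> 'a set \<Rightarrow> bool" where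
  "induces_diamond H S \<longleftrightarrow> S \<subseteq> verts H \<and> is_diamond (H \<restriction> S)"

end

theory Submission
  imports Defs
begin

text \<open>Let \<open>a, b, c, e\<close> be vertices for which \<open>d a c + d b e\<close> exceeds both other sums by at least \<open>m\<close>.
  The injective hull of these four points is a rectangle with four pendant segments. The Helly
  property makes the discrete analogue available: for suitable integral radii \<open>ra, rb, rc, re\<close> there
  are vertices \<open>a', b', c', e'\<close> in the disks around \<open>a, b, c, e\<close> that form a square with sides at most
  \<open>s\<close> and diagonals exactly \<open>A\<close> and \<open>B\<close>, where \<open>A, B \<in> {2s - 1, 2s}\<close>. Integral radii
  exist unless both inequalities are tight and a perimeter has the wrong parity, and then they exist
  for another choice of \<open>A, B, s\<close>. The choices \<open>{A, B} = {2k + 1, 2k + 2}\<close> with \<open>s = k + 1\<close> give (i); the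
  choices \<open>A = B = 2k + 2\<close>, \<open>s = k + 1\<close> and \<open>A = B = 2k + 3\<close>, \<open>s = k + 2\<close> give the two
  configurations of (ii).\<close>

section \<open>Distances and disks\<close>

locale connected_pair_graph = pair_graph G for G :: "'a pair_pre_digraph" +
  assumes conn: "connected G"
begin

abbreviation "V \<equiv> pverts G"
abbreviation "d \<equiv> gdist G"

lemma verts_nonempty: "V \<noteq> {}"
  using conn by (auto simp: connected_def strongly_connected_def)

lemma shortest_awalk:
  assumes "u \<in> V" "v \<in> V"
  obtains p where "awalk u p v" "length p = d u v"
proof -
  have "strongly_connected G"
    using conn by (rule symmetric_connected_imp_strongly_connected[OF sym_arcs])
  then have "u \<rightarrow>\<^sup>*\<^bsub>G\<^esub> v"
    using assms by auto
  then have "\<exists>n p. awalk u p v \<and> length p = n"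
    by (auto simp: reachable_awalk)
  then have "\<exists>p. awalk u p v \<and> length p = d u v"
    unfolding gdist_def by (rule LeastI_ex)
  then show thesis
    using that by blast
qed

lemma gdist_le: "awalk u p v \<Longrightarrow> d u v \<le> length p"
  unfolding gdist_def by (intro Least_le) blast

lemma gdist_self [simp]: "u \<in> V \<Longrightarrow> d u u = 0"
  using gdist_le[of u "[]" u] by (simp add: awalk_Nil_iff)

lemma gdist_pos:
  assumes "u \<in> V" "v \<in> V" "u \<noteq> v"
  shows "0 < d u v"
proof -
  obtain p where "awalk u p v" "length p = d u v"
    using shortest_awalk assms by blast
  then show ?thesis
    using assms by (cases p) (auto simp: awalk_Nil_iff)
qed

lemma gdist_triangle:
  assumes "u \<in> V" "v \<in> V" "w \<in> V"
  shows "d u w \<le> d u v + d v w"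
proof -
  obtain p q where "awalk u p v" "length p = d u v" "awalk v q w" "length q = d v w"
    using shortest_awalk assms by metis
  then show ?thesis
    using gdist_le[OF awalk_appendI] by force
qed

lemma awalk_reverse:
  assumes "awalk u p v"
  shows "\<exists>q. awalk v q u \<and> length q = length p"
  using assms
proof (induction p arbitrary: u)
  case Nil
  then show ?case
    by (auto simp: awalk_Nil_iff)
next
  case (Cons e p)
  then have e: "e \<in> parcs G" "u = fst e" "awalk (snd e) p v"
    by (auto simp: awalk_Cons_iff)
  then obtain q where q: "awalk v q (snd e)" "length q = length p"
    using Cons.IH by blast
  have "(snd e, fst e) \<in> parcs G"
    using e(1) arcs_symmetric[of "fst e" "snd e"] by simp
  then have "awalk (snd e) [(snd e, fst e)] u"
    using e(2) arc_implies_awalk[of "(snd e, fst e)"] by simp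
  then show ?case
    using awalk_appendI[OF q(1)] q(2) by (intro exI[of _ "q @ [(snd e, fst e)]"]) simp
qed

lemma gdist_sym:
  assumes "u \<in> V" "v \<in> V"
  shows "d u v = d v u"
  by (metis assms awalk_reverse gdist_le shortest_awalk order_antisym)

lemma disks_intersect:
  assumes "u \<in> V" "v \<in> V" "d u v \<le> r + q"
  shows "disk G u r \<inter> disk G v q \<noteq> {}"
proof -
  obtain p where p: "awalk u p v" "length p = d u v"
    using shortest_awalk assms by blast
  \<comment> \<open>The vertex reached after \<open>r\<close> steps of a shortest path; if the path
    has at most \<open>r\<close> arcs, this is \<open>v\<close> itself.\<close>
  let ?w = "awlast u (take r p)"
  have w: "awalk u (take r p) ?w" "awalk ?w (drop r p) v"
    using p(1) awalk_append_iff[of u "take r p" "drop r p" v] by auto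
  then have "?w \<in> V"
    using awalk_hd_in_verts by force
  moreover have "d u ?w \<le> r"
    using gdist_le[OF w(1)] by simp
  moreover have "d v ?w \<le> q"
    using gdist_le[OF w(2)] p(2) assms \<open>?w \<in> V\<close> by (simp add: gdist_sym[of v])
  ultimately show ?thesis
    using assms by (auto simp: disk_def gdist_sym)
qed

section \<open>Hyperbolicity as a four-point condition\<close>

text \<open>An integral gap avoids the halves in \<open>hb\<close>. Fixing
  \<open>d a c + d b e\<close> as the largest sum makes \<open>a c\<close> and \<open>b e\<close>
  the diagonals of a quadrilateral, which is how the quadruple is treated from here on.\<close>

definition wide :: "nat \<Rightarrow> bool" where
  "wide m \<longleftrightarrow> (\<exists>a\<in>V. \<exists>b\<in>V. \<exists>c\<in>V. \<exists>e\<in>V.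
     d a b + d c e + m \<le> d a c + d b e \<and> d a e + d b c + m \<le> d a c + d b e)"

lemma wideI:
  assumes "a \<in> V" "b \<in> V" "c \<in> V" "e \<in> V"
    "d a b + d c e + m \<le> d a c + d b e" "d a e + d b c + m \<le> d a c + d b e"
  shows "wide m"
  unfolding wide_def using assms by blast

lemma quad_hb_le_iff:
  "quad_hb G u v w x \<le> real m / 2 \<longleftrightarrow>
   (let X = d u v + d w x; Y = d u w + d v x; Z = d u x + d v w in
     \<not> (Y + Suc m \<le> X \<and> Z + Suc m \<le> X) \<and>
     \<not> (X + Suc m \<le> Y \<and> Z + Suc m \<le> Y) \<and>
     \<not> (X + Suc m \<le> Z \<and> Y + Suc m \<le> Z))"
  unfolding quad_hb_def Let_def
  by (auto simp: numeral_2_eq_2)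

text \<open>All sums of distances are integers, so a gap exceeding \<open>m\<close> is a gap of at
  least \<open>Suc m\<close>.\<close>

lemma hb_le_iff: "hb G \<le> real m / 2 \<longleftrightarrow> \<not> wide (Suc m)"
proof -
  let ?Q = "{quad_hb G u v w x | u v w x. u \<in> V \<and> v \<in> V \<and> w \<in> V \<and> x \<in> V}"
  have "?Q = (\<lambda>(u, v, w, x). quad_hb G u v w x) ` (V \<times> V \<times> V \<times> V)"
    by force
  then have "finite ?Q"
    by simp
  moreover have "?Q \<noteq> {}"
    using verts_nonempty by blast
  ultimately have "hb G \<le> real m / 2 \<longleftrightarrow> (\<forall>q\<in>?Q. q \<le> real m / 2)"
    unfolding hb_def by (rule Max_le_iff)
  also have "\<dots> \<longleftrightarrow> (\<forall>u\<in>V. \<forall>v\<in>V. \<forall>w\<in>V. \<forall>x\<in>V. quad_hb G u v w x \<le> real m / 2)"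
    by blast
  also have "\<dots> \<longleftrightarrow> \<not> wide (Suc m)"
  proof
    assume *: "\<forall>u\<in>V. \<forall>v\<in>V. \<forall>w\<in>V. \<forall>x\<in>V. quad_hb G u v w x \<le> real m / 2"
    show "\<not> wide (Suc m)"
    proof
      assume "wide (Suc m)"
      then obtain a b c e where V: "a \<in> V" "b \<in> V" "c \<in> V" "e \<in> V"
        and le: "d a b + d c e + Suc m \<le> d a c + d b e" "d a e + d b c + Suc m \<le> d a c + d b e"
        unfolding wide_def by blast
      have "quad_hb G a b c e \<le> real m / 2"
        using * V by blast
      then show False
        using le unfolding quad_hb_le_iff Let_def by linarith
    qed
  next
    assume *: "\<not> wide (Suc m)"
    show "\<forall>u\<in>V. \<forall>v\<in>V. \<forall>w\<in>V. \<forall>x\<in>V. quad_hb G u v w x \<le> real m / 2"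
    proof (intro ballI)
      fix u v w x assume V: "u \<in> V" "v \<in> V" "w \<in> V" "x \<in> V"
      note sym = gdist_sym[OF V(1,2)] gdist_sym[OF V(1,3)] gdist_sym[OF V(1,4)]
        gdist_sym[OF V(2,3)] gdist_sym[OF V(2,4)] gdist_sym[OF V(3,4)]
      \<comment> \<open>The three instances of \<open>wideI\<close> relabel the quadruple so that
        each of the three pairings in turn becomes the pair of diagonals.\<close>
      show "quad_hb G u v w x \<le> real m / 2"
        unfolding quad_hb_le_iff Let_def
        using * sym wideI[OF V(1,3,2,4), of "Suc m"] wideI[OF V(1,2,3,4), of "Suc m"]
          wideI[OF V(1,2,4,3), of "Suc m"]
        by linarith
    qed
  qed
  finally show ?thesis .
qed

section \<open>Squares in powers of a graph\<close>

text \<open>The diagonals are left free, since an induced cycle and an induced diamond in a power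
  share the bound on the sides and differ only in a diagonal.\<close>

definition square :: "nat \<Rightarrow> 'a \<Rightarrow> 'a \<Rightarrow> 'a \<Rightarrow> 'a \<Rightarrow> bool" where
  "square s a b c e \<longleftrightarrow> a \<in> V \<and> b \<in> V \<and> c \<in> V \<and> e \<in> V \<and>
     d a b \<le> s \<and> d b c \<le> s \<and> d c e \<le> s \<and> d e a \<le> s"

lemma square_rotate: "square s a b c e \<Longrightarrow> square s b c e a"
  by (auto simp: square_def)

text \<open>The weak inequality for one diagonal serves the diamond with \<open>k = 0\<close>, where
  \<open>d a c = s = 1\<close>. If \<open>a = c\<close>, then \<open>s = 0\<close>, which forces
  \<open>a = b\<close> and contradicts the other diagonal.\<close>

lemma square_distinct:
  assumes "square s a b c e" "s \<le> d a c" "s < d b e"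
  shows "distinct [a, b, c, e]"
proof -
  have V: "a \<in> V" "b \<in> V" "c \<in> V" "e \<in> V"
    and le: "d a b \<le> s" "d b c \<le> s" "d c e \<le> s" "d e a \<le> s"
    using assms(1) by (auto simp: square_def)
  have "a \<noteq> b" "b \<noteq> c" "c \<noteq> e" "e \<noteq> a" "b \<noteq> e"
    using V le assms(3) gdist_sym[of b e] gdist_sym[of b a] by auto
  moreover have "a \<noteq> c"
    using V le(1) assms(2) \<open>a \<noteq> b\<close> gdist_pos[of a b] by auto
  ultimately show ?thesis
    by auto
qed

lemma pverts_graph_power: "pverts (graph_power G l) = V"
  by (simp add: graph_power_def)

lemma arcs_ends_power_eq_iff:
  assumes "S \<subseteq> V" "E \<subseteq> S \<times> S"
  shows "arcs_ends (with_proj (graph_power G l) \<restriction> S) = E \<longleftrightarrow>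
     (\<forall>u\<in>S. \<forall>v\<in>S. u \<noteq> v \<and> d u v \<le> l \<longleftrightarrow> (u, v) \<in> E)"
proof -
  have "arcs_ends (with_proj (graph_power G l) \<restriction> S) =
     {(u, v). u \<in> S \<and> v \<in> S \<and> 0 < d u v \<and> d u v \<le> l}"
    using assms(1) by (auto simp: arcs_ends_conv graph_power_def image_def)
  also have "\<dots> = {(u, v). u \<in> S \<and> v \<in> S \<and> u \<noteq> v \<and> d u v \<le> l}"
    using assms(1) gdist_pos by fastforce
  finally show ?thesis
    using assms(2) by auto
qed

lemma induces_C4_iff:
  assumes "S \<subseteq> V"
  shows "induces_C4 (graph_power G l) S \<longleftrightarrow>
    (\<exists>a b c e. distinct [a, b, c, e] \<and> S = {a, b, c, e} \<and> square l a b c e \<and>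
       l < d a c \<and> l < d b e)"
proof -
  have arcs: "arcs_ends (with_proj (graph_power G l) \<restriction> S) =
      (let E = {(a, b), (b, c), (c, e), (e, a)} in E \<union> E\<inverse>) \<longleftrightarrow>
      square l a b c e \<and> l < d a c \<and> l < d b e"
    if "distinct [a, b, c, e]" and S: "S = {a, b, c, e}" for a b c e
  proof -
    have V: "a \<in> V" "b \<in> V" "c \<in> V" "e \<in> V"
      using assms S by auto
    note sym = gdist_sym[OF V(2,1)] gdist_sym[OF V(3,1)] gdist_sym[OF V(1,4)]
      gdist_sym[OF V(3,2)] gdist_sym[OF V(4,2)] gdist_sym[OF V(4,3)]
    show ?thesis
      unfolding Let_def
      by (subst arcs_ends_power_eq_iff) (use assms that V sym in \<open>auto simp: square_def not_le\<close>)
  qed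
  have "induces_C4 (graph_power G l) S \<longleftrightarrow>
    (\<exists>a b c e. distinct [a, b, c, e] \<and> S = {a, b, c, e} \<and>
      arcs_ends (with_proj (graph_power G l) \<restriction> S) =
        (let E = {(a, b), (b, c), (c, e), (e, a)} in E \<union> E\<inverse>))"
    using assms by (simp add: induces_C4_def is_C4_def pverts_graph_power)
  then show ?thesis
    using arcs by (simp cong: conj_cong)
qed

lemma induces_diamond_iff:
  assumes "S \<subseteq> V"
  shows "induces_diamond (graph_power G l) S \<longleftrightarrow>
    (\<exists>a b c e. distinct [a, b, c, e] \<and> S = {a, b, c, e} \<and> square l a b c e \<and>
       d a c \<le> l \<and> l < d b e)"
proof -
  have arcs: "arcs_ends (with_proj (graph_power G l) \<restriction> S) =
      (let E = {(a, b), (b, c), (c, e), (e, a), (a, c)} in E \<union> E\<inverse>) \<longleftrightarrow>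
      square l a b c e \<and> d a c \<le> l \<and> l < d b e"
    if "distinct [a, b, c, e]" and S: "S = {a, b, c, e}" for a b c e
  proof -
    have V: "a \<in> V" "b \<in> V" "c \<in> V" "e \<in> V"
      using assms S by auto
    note sym = gdist_sym[OF V(2,1)] gdist_sym[OF V(3,1)] gdist_sym[OF V(1,4)]
      gdist_sym[OF V(3,2)] gdist_sym[OF V(4,2)] gdist_sym[OF V(4,3)]
    show ?thesis
      unfolding Let_def
      by (subst arcs_ends_power_eq_iff) (use assms that V sym in \<open>auto simp: square_def not_le\<close>)
  qed
  have "induces_diamond (graph_power G l) S \<longleftrightarrow>
    (\<exists>a b c e. distinct [a, b, c, e] \<and> S = {a, b, c, e} \<and>
      arcs_ends (with_proj (graph_power G l) \<restriction> S) =
        (let E = {(a, b), (b, c), (c, e), (e, a), (a, c)} in E \<union> E\<inverse>))"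
    using assms by (simp add: induces_diamond_def is_diamond_def pverts_graph_power)
  then show ?thesis
    using arcs by (simp cong: conj_cong)
qed

section \<open>Subgraphs induced in a range of powers\<close>

lemma square_mono: "square s a b c e \<Longrightarrow> s \<le> t \<Longrightarrow> square t a b c e"
  by (auto simp: square_def)

lemma square_subset: "square s a b c e \<Longrightarrow> {a, b, c, e} \<subseteq> V"
  by (auto simp: square_def)

lemma square_induces_C4:
  assumes "square l a b c e" "l < d a c" "l < d b e"
  shows "induces_C4 (graph_power G l) {a, b, c, e}"
proof -
  have "distinct [a, b, c, e]"
    using square_distinct assms by simp
  then show ?thesis
    unfolding induces_C4_iff[OF square_subset[OF assms(1)]]
    using assms by (intro exI conjI) (assumption | rule refl)+
qed

lemma square_induces_diamond:
  assumes "square l a b c e" "d a c \<le> l" "l < d b e" "distinct [a, b, c, e]"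
  shows "induces_diamond (graph_power G l) {a, b, c, e}"
  unfolding induces_diamond_iff[OF square_subset[OF assms(1)]]
  using assms by (intro exI conjI) (assumption | rule refl)+

text \<open>Gives a nonneighbour of any vertex without naming the cyclic order, which could a priori
  change from one power to the next.\<close>

lemma induces_C4_nonadjacent:
  assumes "S \<subseteq> V" "induces_C4 (graph_power G l) S" "x \<in> S"
  obtains y where "y \<in> S" "l < d x y" "x \<noteq> y"
proof -
  obtain a b c e where "distinct [a, b, c, e]" "S = {a, b, c, e}" "l < d a c" "l < d b e"
    using assms by (auto simp: induces_C4_iff)
  then show thesis
    using assms(1,3) that[of a] that[of b] that[of c] that[of e] gdist_sym[of a c] gdist_sym[of b e]
    by auto
qed

text \<open>The two missing pairs of the \<open>C\<^sub>4\<close> in the largest power are also missing in the smallest one,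
  so one labelling serves all powers in between.\<close>

lemma C4_range:
  assumes "S \<subseteq> V" "m \<le> n" "\<forall>l\<in>{m..n}. induces_C4 (graph_power G l) S"
  shows "\<exists>a b c e. S = {a, b, c, e} \<and> square m a b c e \<and> n < d a c \<and> n < d b e"
proof -
  have m: "induces_C4 (graph_power G m) S" and n: "induces_C4 (graph_power G n) S"
    using assms by auto
  obtain a b c e where abce: "distinct [a, b, c, e]" "S = {a, b, c, e}" "square m a b c e"
    using m assms(1) by (auto simp: induces_C4_iff)
  have "a \<in> V" "b \<in> V" "c \<in> V" "e \<in> V"
    using abce assms(1) by auto
  then have le: "d a b \<le> n" "d a e \<le> n" "d b a \<le> n" "d b c \<le> n"
    using abce(3) assms(2) gdist_sym[of a e] gdist_sym[of a b] by (auto simp: square_def)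
  \<comment> \<open>Both \<open>b\<close> and \<open>e\<close> are within \<open>n\<close> of
    \<open>a\<close>, so the nonneighbour of \<open>a\<close> in the largest power can only be
    \<open>c\<close>.\<close>
  obtain y where "y \<in> S" "n < d a y" "a \<noteq> y"
    using induces_C4_nonadjacent[OF assms(1) n] abce(2) by blast
  then have "n < d a c"
    using le abce(2) by auto
  moreover obtain z where "z \<in> S" "n < d b z" "b \<noteq> z"
    using induces_C4_nonadjacent[OF assms(1) n] abce(2) by blast
  then have "n < d b e"
    using le abce(2) by auto
  ultimately show ?thesis
    using abce by blast
qed

lemma ex_C4_range_iff:
  assumes "m \<le> n"
  shows "(\<exists>S\<subseteq>V. card S = 4 \<and> (\<forall>l\<in>{m..n}. induces_C4 (graph_power G l) S)) \<longleftrightarrow>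
    (\<exists>a b c e. square m a b c e \<and> n < d a c \<and> n < d b e)" (is "?L \<longleftrightarrow> ?R")
proof
  assume ?L
  then show ?R
    using C4_range[OF _ assms] by metis
next
  assume ?R
  then obtain a b c e where sq: "square m a b c e" and diag: "n < d a c" "n < d b e"
    by blast
  have dist: "distinct [a, b, c, e]"
    using square_distinct[OF sq] diag assms by simp
  have "induces_C4 (graph_power G l) {a, b, c, e}" if "l \<in> {m..n}" for l
  proof -
    have "square l a b c e" "l < d a c" "l < d b e"
      using square_mono[OF sq] that diag by auto
    then show ?thesis
      by (rule square_induces_C4)
  qed
  moreover have "card {a, b, c, e} = 4"
    using dist by auto
  ultimately show ?L
    using square_subset[OF sq] by blast
qed

text \<open>The cycles give both diagonals length at least \<open>2 * k + 1\<close>, and the diamond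
  lets exactly one of them exceed it. The work lies in matching the labelling of the diamond with
  that of the cycles.\<close>

lemma ex_C4_diamond_iff:
  "(\<exists>S\<subseteq>V. card S = 4 \<and> (\<forall>l\<in>{k + 1..2 * k}. induces_C4 (graph_power G l) S) \<and>
      induces_diamond (graph_power G (2 * k + 1)) S) \<longleftrightarrow>
    (\<exists>a b c e. square (k + 1) a b c e \<and> d a c = 2 * k + 1 \<and> 2 * k + 1 < d b e)"
  (is "?L \<longleftrightarrow> ?R")
proof
  assume ?L
  then obtain S where S: "S \<subseteq> V" and C4: "\<forall>l\<in>{k + 1..2 * k}. induces_C4 (graph_power G l) S"
    and "induces_diamond (graph_power G (2 * k + 1)) S"
    by blast
  then obtain a b c e where dist: "distinct [a, b, c, e]" and S_eq: "S = {a, b, c, e}"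
    and sq: "square (2 * k + 1) a b c e" and diag: "d a c \<le> 2 * k + 1" "2 * k + 1 < d b e"
    using induces_diamond_iff by metis
  have V: "a \<in> V" "b \<in> V" "c \<in> V" "e \<in> V"
    using sq by (auto simp: square_def)
  show ?R
  proof (cases "k = 0")
    \<comment> \<open>The range of powers is empty here, so the diamond in the first power alone
      supplies the square.\<close>
    case True
    then have "d a c = 2 * k + 1"
      using gdist_pos[OF V(1,3)] diag(1) dist by simp
    then show ?thesis
      using True sq diag(2) by auto
  next
    case False
    then obtain p q r t where S_eq': "S = {p, q, r, t}" and sq': "square (k + 1) p q r t"
      and diag': "2 * k < d p r" "2 * k < d q t"
      using C4_range[OF S _ C4] by auto
    have pqrt: "p \<in> V" "q \<in> V" "r \<in> V" "t \<in> V"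
      using sq' by (auto simp: square_def)
    note sym = gdist_sym[OF pqrt(2,1)] gdist_sym[OF pqrt(3,1)] gdist_sym[OF pqrt(1,4)]
      gdist_sym[OF pqrt(3,2)] gdist_sym[OF pqrt(4,2)] gdist_sym[OF pqrt(4,3)]
    \<comment> \<open>The pair \<open>b\<close>, \<open>e\<close> missing in the diamond is too far
      apart to be a side of the square \<open>p q r t\<close>.\<close>
    have long: "d p r > 2 * k + 1 \<or> d q t > 2 * k + 1"
    proof -
      have "b \<in> {p, q, r, t}" "e \<in> {p, q, r, t}"
        using S_eq S_eq' by auto
      then show ?thesis
        using diag(2) sq' sym pqrt by (auto simp: square_def)
    qed
    have only: "{x, y} = {b, e}" if "x \<in> S" "y \<in> S" "2 * k + 1 < d x y" for x y
      using that sq diag V gdist_sym[OF V(2,1)] gdist_sym[OF V(3,1)] gdist_sym[OF V(1,4)]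
        gdist_sym[OF V(3,2)] gdist_sym[OF V(4,3)]
      unfolding S_eq by (auto simp: square_def)
    have short: "d p r \<le> 2 * k + 1 \<or> d q t \<le> 2 * k + 1"
    proof (rule ccontr)
      assume "\<not> ?thesis"
      then have far: "2 * k + 1 < d p r" "2 * k + 1 < d q t"
        by auto
      then have "{p, r} = {q, t}"
        using only[of p r] only[of q t] S_eq' by auto
      moreover have "distinct [p, q, r, t]"
        using square_distinct[OF sq'] far by simp
      ultimately show False
        by auto
    qed
    show ?thesis
    proof (cases "d p r \<le> 2 * k + 1")
      case True
      then have "d p r = 2 * k + 1"
        using diag' by simp
      then show ?thesis
        using True long sq' by fastforce
    next
      case False
      then have "d q t = 2 * k + 1" "2 * k + 1 < d r p"
        using short diag' sym by auto
      then show ?thesis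
        using square_rotate[OF sq'] by blast
    qed
  qed
next
  assume ?R
  then obtain a b c e where sq: "square (k + 1) a b c e"
    and diag: "d a c = 2 * k + 1" "2 * k + 1 < d b e"
    by blast
  have dist: "distinct [a, b, c, e]"
    using square_distinct[OF sq] diag by simp
  have "induces_C4 (graph_power G l) {a, b, c, e}" if "l \<in> {k + 1..2 * k}" for l
  proof -
    have "square l a b c e" "l < d a c" "l < d b e"
      using square_mono[OF sq] that diag by auto
    then show ?thesis
      by (rule square_induces_C4)
  qed
  moreover have "induces_diamond (graph_power G (2 * k + 1)) {a, b, c, e}"
  proof -
    have "square (2 * k + 1) a b c e" "d a c \<le> 2 * k + 1"
      using square_mono[OF sq] diag by auto
    then show ?thesis
      using diag(2) dist by (rule square_induces_diamond)
  qed
  moreover have "card {a, b, c, e} = 4"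
    using dist by auto
  ultimately show ?L
    using square_subset[OF sq] by blast
qed

text \<open>Opposite sides sum to at most \<open>2 * s\<close>. This is the converse direction of
  both characterisations of \<open>wide\<close>.\<close>

lemma square_wide:
  assumes "square s a b c e" "2 * s + m \<le> d a c + d b e"
  shows "wide m"
proof (rule wideI)
  show "a \<in> V" "b \<in> V" "c \<in> V" "e \<in> V"
    using assms(1) by (auto simp: square_def)
  then show "d a b + d c e + m \<le> d a c + d b e" "d a e + d b c + m \<le> d a c + d b e"
    using assms gdist_sym[of a e] by (auto simp: square_def)
qed

end

section \<open>Shrinking a quadruple in a Helly graph\<close>

locale helly_graph = connected_pair_graph +
  assumes helly: "F \<subseteq> {disk G v r | v r. v \<in> pverts G} \<Longrightarrow>
    (\<And>A B. A \<in> F \<Longrightarrow> B \<in> F \<Longrightarrow> A \<inter> B \<noteq> {}) \<Longrightarrow> \<exists>c\<in>pverts G. \<forall>A\<in>F. c \<in> A"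
begin

text \<open>Since disks meet as soon as their radii add up to the distance of the centres, the Helly
  property can be applied by checking linear inequalities.\<close>

lemma common_vertex:
  assumes "fst ` P \<subseteq> V"
    and "\<And>u r v q. (u, r) \<in> P \<Longrightarrow> (v, q) \<in> P \<Longrightarrow> d u v \<le> r + q"
  shows "\<exists>c\<in>V. \<forall>(u, r)\<in>P. d u c \<le> r"
proof -
  have "\<exists>c\<in>V. \<forall>A\<in>(\<lambda>(u, r). disk G u r) ` P. c \<in> A"
  proof (rule helly)
    show "(\<lambda>(u, r). disk G u r) ` P \<subseteq> {disk G v r | v r. v \<in> V}"
      using assms(1) by force
    fix A B
    assume "A \<in> (\<lambda>(u, r). disk G u r) ` P" "B \<in> (\<lambda>(u, r). disk G u r) ` P"
    then obtain u r v q where "(u, r) \<in> P" "A = disk G u r" "(v, q) \<in> P" "B = disk G v q"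
      by auto
    then show "A \<inter> B \<noteq> {}"
      using assms disks_intersect[of u v r q] by force
  qed
  then obtain c where "c \<in> V" and c: "\<And>u r. (u, r) \<in> P \<Longrightarrow> c \<in> disk G u r"
    by auto
  moreover have "d u c \<le> r" if "(u, r) \<in> P" for u r
    using c[OF that] assms(1) that gdist_sym[of u c] by (force simp: disk_def)
  ultimately show ?thesis
    by (intro bexI[of _ c]) auto
qed

lemma common_vertex4:
  assumes "x1 \<in> V" "x2 \<in> V" "x3 \<in> V" "x4 \<in> V"
    and "d x1 x2 \<le> r1 + r2" "d x1 x3 \<le> r1 + r3" "d x1 x4 \<le> r1 + r4"
      "d x2 x3 \<le> r2 + r3" "d x2 x4 \<le> r2 + r4" "d x3 x4 \<le> r3 + r4"
  shows "\<exists>c\<in>V. d x1 c \<le> r1 \<and> d x2 c \<le> r2 \<and> d x3 c \<le> r3 \<and> d x4 c \<le> r4"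
proof -
  let ?P = "{(x1, r1), (x2, r2), (x3, r3), (x4, r4)}"
  have "\<exists>c\<in>V. \<forall>(u, r)\<in>?P. d u c \<le> r"
  proof (rule common_vertex)
    show "fst ` ?P \<subseteq> V"
      using assms by auto
    show "d u v \<le> r + q" if "(u, r) \<in> ?P" "(v, q) \<in> ?P" for u r v q
      using that assms gdist_sym by (auto simp: add.commute)
  qed
  then show ?thesis
    by auto
qed

end

text \<open>The side conditions say that \<open>p = ra + rb\<close> and \<open>q = ra - rb\<close> lie in two nonempty intervals;
  both need the same parity. The triangle inequalities make all radii nonnegative.\<close>

lemma shrinking_radii:
  fixes ab bc ce ae ac be A B s :: nat
  assumes tri: "ac \<le> ab + bc" "ac \<le> ae + ce" "be \<le> ab + ae" "be \<le> bc + ce"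
    and AB: "2 * s \<le> A + 1" "2 * s \<le> B + 1"
    and le: "ab + ce + A + B \<le> ac + be + 2 * s" "ae + bc + A + B \<le> ac + be + 2 * s"
    and parity: "even (ab + ae + be + B) \<or> ab + ce + A + B < ac + be + 2 * s \<or>
      ae + bc + A + B < ac + be + 2 * s"
  obtains ra rb rc re where "ra + rc + A = ac" "rb + re + B = be"
    "ab \<le> ra + rb + s" "bc \<le> rb + rc + s" "ce \<le> rc + re + s" "ae \<le> ra + re + s"
proof -
  \<comment> \<open>Substituting \<open>rc = ac - A - ra\<close> and
    \<open>re = be - B - rb\<close>, the conditions on \<open>ab\<close> and \<open>ce\<close> bound
    \<open>p\<close>, those on \<open>ae\<close> and \<open>bc\<close> bound
    \<open>q\<close>.\<close>
  have "\<exists>p q :: int. even (p + q) \<and> int ab - s \<le> p \<and> p \<le> int ac + be - A - B + s - ce \<and>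
      int ae - be + B - s \<le> q \<and> q \<le> int ac - A + s - bc"
  proof (cases "even (ab + ae + be + B)")
    case True
    then have "even ((int ab - s) + (int ae - be + B - s))"
      by presburger
    then show ?thesis
      using le by (intro exI[of _ "int ab - s"] exI[of _ "int ae - be + B - s"]) linarith
  next
    case False
    then have odd: "odd ((int ab - s) + (int ae - be + B - s))"
      by presburger
    \<comment> \<open>The lower ends have opposite parities, but one interval has room to raise its
      lower end by one.\<close>
    from False parity consider "ab + ce + A + B < ac + be + 2 * s"
      | "ae + bc + A + B < ac + be + 2 * s"
      by blast
    then show ?thesis
    proof cases
      case 1
      then show ?thesis
        using le odd
        by (intro exI[of _ "int ab - s + 1"] exI[of _ "int ae - be + B - s"]) auto
    next
      case 2
      then show ?thesis
        using le odd
        by (intro exI[of _ "int ab - s"] exI[of _ "int ae - be + B - s + 1"]) auto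
    qed
  qed
  then obtain p q :: int where "even (p + q)"
    and p: "int ab - s \<le> p" "p \<le> int ac + be - A - B + s - ce"
    and q: "int ae - be + B - s \<le> q" "q \<le> int ac - A + s - bc"
    by blast
  then obtain x where x: "p + q = 2 * x"
    by blast
  let ?y = "p - x"
  \<comment> \<open>Twice each radius is at least \<open>A - 2 * s\<close> or
    \<open>B - 2 * s\<close>, hence at least -1; integrality then makes the radius
    nonnegative.\<close>
  have nonneg: "0 \<le> x" "0 \<le> ?y" "0 \<le> int ac - A - x" "0 \<le> int be - B - ?y"
    using p q x tri AB by linarith+
  show thesis
    using nonneg p q x
    by (intro that[of "nat x" "nat (int ac - A - x)" "nat ?y" "nat (int be - B - ?y)"]) linarith+
qed

section \<open>Wide quadruples and squares\<close>

context helly_graph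
begin

text \<open>The new vertices are chosen one at a time near the old ones. As \<open>a\<close>, \<open>c\<close> move by at most
  \<open>d a c - A\<close> in total, the distance of \<open>a'\<close> and \<open>c'\<close> cannot drop below \<open>A\<close>.\<close>

lemma shrink_quadruple:
  assumes V: "a \<in> V" "b \<in> V" "c \<in> V" "e \<in> V"
    and AB: "2 * s \<le> A + 1" "2 * s \<le> B + 1" "A \<le> 2 * s" "B \<le> 2 * s"
    and le: "d a b + d c e + A + B \<le> d a c + d b e + 2 * s"
      "d a e + d b c + A + B \<le> d a c + d b e + 2 * s"
    and parity: "even (d a b + d a e + d b e + B) \<or>
      d a b + d c e + A + B < d a c + d b e + 2 * s \<or>
      d a e + d b c + A + B < d a c + d b e + 2 * s"
  shows "\<exists>a' b' c' e'. square s a' b' c' e' \<and> d a' c' = A \<and> d b' e' = B"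
proof -
  note sym = gdist_sym[OF V(1,2)] gdist_sym[OF V(1,3)] gdist_sym[OF V(1,4)]
    gdist_sym[OF V(2,3)] gdist_sym[OF V(2,4)] gdist_sym[OF V(3,4)]
  have tri: "d a c \<le> d a b + d b c" "d a c \<le> d a e + d c e"
    "d b e \<le> d a b + d a e" "d b e \<le> d b c + d c e"
    using gdist_triangle[OF V(1,2,3)] gdist_triangle[OF V(1,4,3)]
      gdist_triangle[OF V(2,1,4)] gdist_triangle[OF V(2,3,4)] sym by linarith+
  obtain ra rb rc re where r: "ra + rc + A = d a c" "rb + re + B = d b e"
    "d a b \<le> ra + rb + s" "d b c \<le> rb + rc + s" "d c e \<le> rc + re + s" "d a e \<le> ra + re + s"
    by (rule shrinking_radii[OF tri AB(1,2) le parity])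
  \<comment> \<open>The enlarged radii at \<open>b\<close>, \<open>c\<close>, \<open>e\<close>
    reserve a side or a diagonal for the vertices still to be chosen, so that the later disks meet.
    The bounds \<open>A \<le> 2 * s\<close> and \<open>B \<le> 2 * s\<close> enter where two sides
    must cover a diagonal.\<close>
  have "\<exists>x\<in>V. d a x \<le> ra \<and> d b x \<le> rb + s \<and> d c x \<le> rc + A \<and> d e x \<le> re + s"
    by (rule common_vertex4) (use V in fast | use r AB in linarith)+
  then obtain a' where a': "a' \<in> V" "d a a' \<le> ra" "d b a' \<le> rb + s" "d c a' \<le> rc + A"
      "d e a' \<le> re + s"
    by blast
  note sym_a = gdist_sym[OF a'(1) V(1)] gdist_sym[OF a'(1) V(2)] gdist_sym[OF a'(1) V(3)]
    gdist_sym[OF a'(1) V(4)]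
  have "\<exists>x\<in>V. d a' x \<le> s \<and> d b x \<le> rb \<and> d c x \<le> rc + s \<and> d e x \<le> re + B"
    by (rule common_vertex4) (use V a' in fast | use r AB a' sym_a in linarith)+
  then obtain b' where b': "b' \<in> V" "d a' b' \<le> s" "d b b' \<le> rb" "d c b' \<le> rc + s"
      "d e b' \<le> re + B"
    by blast
  note sym_b = gdist_sym[OF b'(1) V(1)] gdist_sym[OF b'(1) V(2)] gdist_sym[OF b'(1) V(3)]
    gdist_sym[OF b'(1) V(4)]
  have "\<exists>x\<in>V. d a' x \<le> A \<and> d b' x \<le> s \<and> d c x \<le> rc \<and> d e x \<le> re + s"
    by (rule common_vertex4) (use V a' b' in fast | use r AB a' b' sym_a sym_b in linarith)+
  then obtain c' where c': "c' \<in> V" "d a' c' \<le> A" "d b' c' \<le> s" "d c c' \<le> rc" "d e c' \<le> re + s"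
    by blast
  note sym_c = gdist_sym[OF c'(1) V(1)] gdist_sym[OF c'(1) V(2)] gdist_sym[OF c'(1) V(3)]
    gdist_sym[OF c'(1) V(4)]
  have "\<exists>x\<in>V. d a' x \<le> s \<and> d b' x \<le> B \<and> d c' x \<le> s \<and> d e x \<le> re"
    by (rule common_vertex4)
      (use V a' b' c' in fast | use r AB a' b' c' sym_a sym_b sym_c in linarith)+
  then obtain e' where e': "e' \<in> V" "d a' e' \<le> s" "d b' e' \<le> B" "d c' e' \<le> s" "d e e' \<le> re"
    by blast
  have "d a c \<le> d a a' + d a' c' + d c c'"
    using gdist_triangle[OF V(1) a'(1) V(3)] gdist_triangle[OF a'(1) c'(1) V(3)] sym_c by linarith
  moreover have "d b e \<le> d b b' + d b' e' + d e e'"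
    using gdist_triangle[OF V(2) b'(1) V(4)] gdist_triangle[OF b'(1) e'(1) V(4)]
      gdist_sym[OF e'(1) V(4)] by linarith
  ultimately have "d a' c' = A" "d b' e' = B"
    using r a' b' c' e' by linarith+
  moreover have "square s a' b' c' e'"
    using a' b' c' e' gdist_sym[OF e'(1) a'(1)] by (simp add: square_def)
  ultimately show ?thesis
    by blast
qed

text \<open>The diagonals \<open>2 * k + 1\<close> and \<open>2 * k + 2\<close> with sides
  \<open>k + 1\<close> use up the gap exactly. Their order is free, so \<open>B\<close> can be
  chosen with the parity of the perimeter of \<open>a\<close>, \<open>b\<close>, \<open>e\<close>,
  and integral radii always exist.\<close>

lemma wide_odd_iff:
  "wide (2 * k + 1) \<longleftrightarrow>
    (\<exists>a b c e. square (k + 1) a b c e \<and> d a c = 2 * k + 1 \<and> 2 * k + 1 < d b e)"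
  (is "_ \<longleftrightarrow> ?R")
proof
  assume "wide (2 * k + 1)"
  then obtain a b c e where V: "a \<in> V" "b \<in> V" "c \<in> V" "e \<in> V"
    and le: "d a b + d c e + (2 * k + 1) \<le> d a c + d b e"
      "d a e + d b c + (2 * k + 1) \<le> d a c + d b e"
    unfolding wide_def by blast
  show ?R
  proof (cases "even (d a b + d a e + d b e)")
    case True
    have "\<exists>a' b' c' e'. square (k + 1) a' b' c' e' \<and>
        d a' c' = 2 * k + 1 \<and> d b' e' = 2 * k + 2"
      by (rule shrink_quadruple[OF V]) (use le True in auto)
    then obtain a' b' c' e' where "square (k + 1) a' b' c' e'" "d a' c' = 2 * k + 1"
      "d b' e' = 2 * k + 2"
      by blast
    then show ?thesis
      by fastforce
  next
    case False
    have "\<exists>a' b' c' e'. square (k + 1) a' b' c' e' \<and>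
        d a' c' = 2 * k + 2 \<and> d b' e' = 2 * k + 1"
      by (rule shrink_quadruple[OF V]) (use le False in auto)
    then obtain a' b' c' e' where sq: "square (k + 1) a' b' c' e'" and "d a' c' = 2 * k + 2"
      "d b' e' = 2 * k + 1"
      by blast
    \<comment> \<open>Rotating the square puts the diagonal of length \<open>2 * k + 1\<close>
      first.\<close>
    moreover have "d c' a' = d a' c'"
      using sq gdist_sym by (auto simp: square_def)
    ultimately show ?thesis
      using square_rotate[OF sq] by fastforce
  qed
next
  assume ?R
  then show "wide (2 * k + 1)"
    by (auto intro!: square_wide)
qed

text \<open>An odd perimeter rules out integral radii for a square with sides \<open>k + 1\<close> when the two
  smaller sums attain the bound; then a slightly larger square with shortened diagonals fits.\<close>

lemma wide_even_iff:
  "wide (2 * k + 2) \<longleftrightarrow>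
    (\<exists>a b c e. square (k + 1) a b c e \<and> 2 * k + 1 < d a c \<and> 2 * k + 1 < d b e) \<or>
    (\<exists>a b c e. square (k + 2) a b c e \<and> 2 * k + 2 < d a c \<and> 2 * k + 2 < d b e)"
  (is "_ \<longleftrightarrow> ?R1 \<or> ?R2")
proof
  assume "wide (2 * k + 2)"
  then obtain a b c e where V: "a \<in> V" "b \<in> V" "c \<in> V" "e \<in> V"
    and le: "d a b + d c e + (2 * k + 2) \<le> d a c + d b e"
      "d a e + d b c + (2 * k + 2) \<le> d a c + d b e"
    unfolding wide_def by blast
  show "?R1 \<or> ?R2"
  proof (cases "even (d a b + d a e + d b e)")
    case True
    have "\<exists>a' b' c' e'. square (k + 1) a' b' c' e' \<and>
        d a' c' = 2 * k + 2 \<and> d b' e' = 2 * k + 2"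
      by (rule shrink_quadruple[OF V]) (use le True in auto)
    then obtain a' b' c' e' where "square (k + 1) a' b' c' e'" "d a' c' = 2 * k + 2"
      "d b' e' = 2 * k + 2"
      by blast
    then have ?R1
      by fastforce
    then show ?thesis ..
  next
    case False
    have "\<exists>a' b' c' e'. square (k + 2) a' b' c' e' \<and>
        d a' c' = 2 * k + 3 \<and> d b' e' = 2 * k + 3"
      by (rule shrink_quadruple[OF V]) (use le False in auto)
    then obtain a' b' c' e' where "square (k + 2) a' b' c' e'" "d a' c' = 2 * k + 3"
      "d b' e' = 2 * k + 3"
      by blast
    then have ?R2
      by fastforce
    then show ?thesis ..
  qed
next
  assume "?R1 \<or> ?R2"
  then show "wide (2 * k + 2)"
  proof
    assume ?R1
    then show ?thesis
      by (auto intro!: square_wide)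
  next
    assume ?R2
    then show ?thesis
      by (auto intro!: square_wide)
  qed
qed

end

theorem theorem4:
  fixes G :: "'a pair_pre_digraph" and k :: nat
  assumes "Helly_graph G"
  shows "(hb G \<le> real k \<longleftrightarrow>
      \<not> (\<exists>S \<subseteq> pverts G. card S = 4 \<and>
           (\<forall>l\<in>{k + 1..2 * k}. induces_C4 (graph_power G l) S) \<and>
           induces_diamond (graph_power G (2 * k + 1)) S)) \<and>
    (hb G \<le> real k + 1 / 2 \<longleftrightarrow>
      \<not> (\<exists>S \<subseteq> pverts G. card S = 4 \<and>
           (\<forall>l\<in>{k + 1..2 * k + 1}. induces_C4 (graph_power G l) S)) \<and>
      \<not> (\<exists>S \<subseteq> pverts G. card S = 4 \<and>
           (\<forall>l\<in>{k + 2..2 * k + 2}. induces_C4 (graph_power G l) S)))"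
proof -
  interpret helly_graph G
  proof -
    interpret pair_graph G
      using assms unfolding Helly_graph_def by (rule conjunct1)
    show "helly_graph G"
    proof unfold_locales
      show "connected G"
        using assms unfolding Helly_graph_def by blast
      show "\<exists>c\<in>pverts G. \<forall>A\<in>F. c \<in> A"
        if "F \<subseteq> {disk G v r | v r. v \<in> pverts G}"
          "\<And>A B. A \<in> F \<Longrightarrow> B \<in> F \<Longrightarrow> A \<inter> B \<noteq> {}" for F
        using assms that unfolding Helly_graph_def by meson
    qed
  qed
  have "hb G \<le> real k \<longleftrightarrow> \<not> wide (2 * k + 1)"
    using hb_le_iff[of "2 * k"] by simp
  moreover have "hb G \<le> real k + 1 / 2 \<longleftrightarrow> \<not> wide (2 * k + 2)"
    using hb_le_iff[of "2 * k + 1"] by (simp add: add_divide_distrib add.commute)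
  moreover have "(\<exists>S\<subseteq>V. card S = 4 \<and>
      (\<forall>l\<in>{k + 1..2 * k + 1}. induces_C4 (graph_power G l) S)) \<longleftrightarrow>
      (\<exists>a b c e. square (k + 1) a b c e \<and> 2 * k + 1 < d a c \<and> 2 * k + 1 < d b e)"
    by (rule ex_C4_range_iff) simp
  moreover have "(\<exists>S\<subseteq>V. card S = 4 \<and>
      (\<forall>l\<in>{k + 2..2 * k + 2}. induces_C4 (graph_power G l) S)) \<longleftrightarrow>
      (\<exists>a b c e. square (k + 2) a b c e \<and> 2 * k + 2 < d a c \<and> 2 * k + 2 < d b e)"
    by (rule ex_C4_range_iff) simp
  ultimately show ?thesis
    by (simp only: ex_C4_diamond_iff wide_odd_iff wide_even_iff de_Morgan_disj)
qed

end
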